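(* Let $p$ be an analytic function on the open unit disk $\mathbb{D}=\{z\in\mathbb{C}:|z|<1\}$, normalized such that $p(0)=1$. If \[ \left| zp'(z)+p(z)+p(z)^2-2\right| <\frac52 \quad \text{for all } z\in\mathbb{D}, \] then $\operatorname{Re} p(z)>0$ for all $z\in\mathbb{D}$.
   Context: $\mathbb{D}$ denotes the open unit disk in the complex plane. *)

theory Defs
  imports "HOL-Complex_Analysis.Complex_Analysis"
begin

end

theory Submission
  imports Defs
begin

text \<open>
  The proof is a boundary-point argument in the style of Jack, Miller and Mocanu. If
  \<open>Re p\<close> is not positive throughout the disk, let \<open>\<zeta>\<close> be a point of least modulus with
  \<open>Re (p \<zeta>) \<le> 0\<close>; by continuity \<open>p \<zeta> = \<i>x\<close> is purely imaginary (lemma \<open>first_boundary_point\<close>).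
  On the disk of radius \<open>\<bar>\<zeta>\<bar>\<close> the function \<open>p\<close> maps into the right half-plane, so Schwarz's
  lemma for the Cayley transform \<open>(1 - p) / (1 + p)\<close> controls how fast \<open>p\<close> can approach the
  imaginary axis along the radius towards \<open>\<zeta>\<close> (lemma \<open>schwarz_right_halfplane\<close>). The estimate
  is sharp at \<open>\<zeta>\<close> itself, and comparing radial derivatives there gives
  \<open>Re (\<zeta> p'(\<zeta>)) \<le> - (1 + x\<^sup>2) / 2\<close> (lemma \<open>radial_derivative_at_boundary_point\<close>). Then
  \<open>Re (\<zeta> p'(\<zeta>) + p(\<zeta>) + p(\<zeta>)\<^sup>2 - 2) \<le> - (1 + x\<^sup>2) / 2 - x\<^sup>2 - 2 \<le> - 5 / 2\<close>,
  so the modulus of this expression is at least \<open>5 / 2\<close>, contrary to the hypothesis.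
\<close>

text \<open>
  This is Schwarz's lemma for the Cayley transform \<open>(1 - p) / (1 + p)\<close>, which sends the right
  half-plane to the unit disk and 1 to 0. Clearing the denominator leaves moduli of
  affine functions of \<open>p\<close>, whose squares are polynomials in \<open>Re p\<close> and \<open>Im p\<close> and hence easy
  to differentiate along a radius.
\<close>

lemma schwarz_right_halfplane:
  fixes p :: "complex \<Rightarrow> complex"
  assumes hol: "p holomorphic_on ball 0 r"
    and p0: "p 0 = 1"
    and pos: "\<And>z. z \<in> ball 0 r \<Longrightarrow> Re (p z) > 0"
    and z: "z \<in> ball 0 r"
  shows "r * cmod (1 - p z) \<le> cmod z * cmod (1 + p z)"
proof -
  have r: "r > 0"
    using z by (auto intro: le_less_trans[OF norm_ge_zero])
  define g where "g u = (1 - p (of_real r * u)) / (1 + p (of_real r * u))" for u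
  have in_ball: "of_real r * u \<in> ball 0 r" if "cmod u < 1" for u
    using that r by (simp add: norm_mult)
  have nz: "1 + p u \<noteq> 0" if "u \<in> ball 0 r" for u
    using pos[OF that] by (auto simp: complex_eq_iff)
  have "(\<lambda>u. p (of_real r * u)) holomorphic_on ball 0 1"
    using in_ball by (intro holomorphic_on_compose_gen[OF _ hol, unfolded o_def] holomorphic_intros) auto
  then have g_hol: "g holomorphic_on ball 0 1"
    unfolding g_def using nz in_ball by (intro holomorphic_intros) auto
  have g_less: "cmod (g u) < 1" if "cmod u < 1" for u
  proof -
    let ?q = "p (of_real r * u)"
    have "Re ?q > 0"
      using pos in_ball that by blast
    then have "(cmod (1 - ?q))\<^sup>2 < (cmod (1 + ?q))\<^sup>2"
      unfolding cmod_power2 by (simp add: power2_eq_square algebra_simps)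
    then have "cmod (1 - ?q) < cmod (1 + ?q)"
      by (rule power2_less_imp_less) simp
    then show ?thesis
      by (simp add: g_def norm_divide divide_less_eq)
  qed
  have "cmod (z / of_real r) < 1"
    using z r by (simp add: norm_divide)
  moreover have "g 0 = 0"
    by (simp add: g_def p0)
  ultimately have "cmod (g (z / of_real r)) \<le> cmod (z / of_real r)"
    using Schwarz_Lemma(1)[OF g_hol] g_less by blast
  then have "cmod (1 - p z) / cmod (1 + p z) \<le> cmod z / r"
    using r by (simp add: g_def norm_divide)
  moreover have "cmod (1 + p z) > 0"
    using nz[OF z] by simp
  ultimately show ?thesis
    using r by (simp add: field_simps)
qed

text \<open>
  The part of the closed disk through \<open>w\<close> on which \<open>Re p \<le> 0\<close> is compact, so it has a point of
  least modulus; approaching that point radially from inside shows that \<open>Re p\<close> vanishes there.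
\<close>

lemma first_boundary_point:
  fixes p :: "complex \<Rightarrow> complex"
  assumes cont: "continuous_on (ball 0 R) p"
    and p0: "Re (p 0) > 0"
    and w: "w \<in> ball 0 R" "Re (p w) \<le> 0"
  obtains \<zeta> where "\<zeta> \<in> ball 0 R" "\<zeta> \<noteq> 0" "Re (p \<zeta>) = 0"
    "\<And>z. cmod z < cmod \<zeta> \<Longrightarrow> Re (p z) > 0"
proof -
  define K where "K = {z \<in> cball 0 (cmod w). Re (p z) \<le> 0}"
  have sub: "cball 0 (cmod w) \<subseteq> ball 0 R"
    using w(1) by auto
  have "continuous_on (cball 0 (cmod w)) (\<lambda>z. Re (p z))"
    using continuous_on_subset[OF cont sub] by (intro continuous_intros)
  then have "closed K"
    unfolding K_def by (intro continuous_on_closed_Collect_le) auto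
  moreover have "bounded K"
    unfolding K_def by (rule bounded_subset[OF bounded_cball[of 0 "cmod w"]]) auto
  ultimately have "compact K"
    by (simp add: compact_eq_bounded_closed)
  moreover have "K \<noteq> {}"
    using w by (auto simp: K_def)
  ultimately obtain \<zeta> where \<zeta>: "\<zeta> \<in> K" and least: "\<And>z. z \<in> K \<Longrightarrow> cmod \<zeta> \<le> cmod z"
    using continuous_attains_inf[of K cmod] continuous_on_norm_id by blast
  have inside: "\<zeta> \<in> ball 0 R"
    using \<zeta> w(1) by (auto simp: K_def)
  have nz: "\<zeta> \<noteq> 0"
    using \<zeta> p0 by (auto simp: K_def)
  have pos: "Re (p z) > 0" if "cmod z < cmod \<zeta>" for z
    using least[of z] that \<zeta> by (force simp: K_def)
  have "isCont p \<zeta>"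
    using cont inside continuous_on_interior[of "ball 0 R" p \<zeta>] by simp
  moreover have "((\<lambda>t. of_real t * \<zeta>) \<longlongrightarrow> of_real 1 * \<zeta>) (at_left 1)"
    by (intro tendsto_intros)
  ultimately have "((\<lambda>t. Re (p (of_real t * \<zeta>))) \<longlongrightarrow> Re (p \<zeta>)) (at_left 1)"
    using isCont_tendsto_compose[of \<zeta> p] by (intro tendsto_Re) auto
  moreover have "\<forall>\<^sub>F t in at_left (1::real). 0 \<le> Re (p (of_real t * \<zeta>))"
    using eventually_at_left_real[of 0 1]
  proof (rule eventually_mono)
    fix t :: real assume "t \<in> {0<..<1}"
    then have "cmod (of_real t * \<zeta>) < cmod \<zeta>"
      using nz by (simp add: norm_mult)
    then show "0 \<le> Re (p (of_real t * \<zeta>))"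
      using pos less_imp_le by blast
  qed simp
  ultimately have "Re (p \<zeta>) \<ge> 0"
    by (rule tendsto_lowerbound) simp
  then have "Re (p \<zeta>) = 0"
    using \<zeta> by (simp add: K_def)
  then show thesis
    using that inside nz pos by blast
qed

text \<open>
  Since \<open>Re (p \<zeta>) = 0\<close>, the points \<open>1 \<plusminus> p \<zeta>\<close> have equal modulus, so the Schwarz estimate
  becomes an equality at \<open>\<zeta>\<close>. Hence the nonnegative gap between its two sides (squared) vanishes
  at \<open>\<zeta>\<close>, and its radial derivative at \<open>\<zeta>\<close> cannot be positive.
\<close>

lemma radial_derivative_at_boundary_point:
  fixes p :: "complex \<Rightarrow> complex"
  assumes hol: "p holomorphic_on ball 0 (cmod \<zeta>)"
    and diff: "p field_differentiable at \<zeta>"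
    and p0: "p 0 = 1"
    and nz: "\<zeta> \<noteq> 0"
    and Re0: "Re (p \<zeta>) = 0"
    and pos: "\<And>z. cmod z < cmod \<zeta> \<Longrightarrow> Re (p z) > 0"
  shows "Re (\<zeta> * deriv p \<zeta>) \<le> - (1 + (Im (p \<zeta>))\<^sup>2) / 2"
proof (rule ccontr)
  assume contra: "\<not> ?thesis"
  define q where "q t = p (of_real t * \<zeta>)" for t :: real
  define D where "D = \<zeta> * deriv p \<zeta>"
  \<comment> \<open>The gap \<open>t\<^sup>2 \<bar>1 + q t\<bar>\<^sup>2 - \<bar>1 - q t\<bar>\<^sup>2\<close>, written in real coordinates.\<close>
  define F where "F t = t\<^sup>2 * ((1 + Re (q t))\<^sup>2 + (Im (q t))\<^sup>2)
                        - ((1 - Re (q t))\<^sup>2 + (Im (q t))\<^sup>2)" for t :: real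
  have "(p has_field_derivative deriv p \<zeta>) (at \<zeta>)"
    using diff by (simp add: DERIV_deriv_iff_field_differentiable)
  moreover have "((\<lambda>t. of_real t * \<zeta>) has_vector_derivative \<zeta>) (at 1)"
    by (auto intro!: derivative_eq_intros)
  ultimately have q': "(q has_vector_derivative D) (at 1)"
    unfolding q_def D_def
    using field_vector_diff_chain_at[of "\<lambda>t. of_real t * \<zeta>" \<zeta> 1 p "deriv p \<zeta>"]
    by (simp add: o_def)
  have Re': "((\<lambda>t. Re (q t)) has_real_derivative Re D) (at 1)"
    and Im': "((\<lambda>t. Im (q t)) has_real_derivative Im D) (at 1)"
    using has_vector_derivative_complex_iff q' by blast+
  have q1: "q 1 = p \<zeta>"
    by (simp add: q_def)
  have deriv_gap: "((\<lambda>t. t\<^sup>2 * ((1 + a t)\<^sup>2 + (b t)\<^sup>2) - ((1 - a t)\<^sup>2 + (b t)\<^sup>2))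
      has_real_derivative 2 * (1 + (b 1)\<^sup>2) + 4 * a') (at 1)"
    if a: "(a has_real_derivative a') (at 1)" and b: "(b has_real_derivative b') (at 1)"
      and "a 1 = 0" for a b :: "real \<Rightarrow> real" and a' b'
    by (rule derivative_eq_intros a b refl | simp add: \<open>a 1 = 0\<close> algebra_simps power2_eq_square)+
  have "(F has_real_derivative 2 * (1 + (Im (p \<zeta>))\<^sup>2) + 4 * Re D) (at 1)"
    unfolding F_def using deriv_gap[OF Re' Im'] Re0 by (simp add: q1)
  moreover have "2 * (1 + (Im (p \<zeta>))\<^sup>2) + 4 * Re D > 0"
    using contra by (simp add: D_def)
  ultimately obtain d where d: "d > 0" "\<And>h. 0 < h \<Longrightarrow> h < d \<Longrightarrow> F (1 - h) < F 1"
    using DERIV_pos_inc_left by blast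
  define h where "h = min (d / 2) (1 / 2)"
  have h: "0 < h" "h < d" "h < 1"
    using d(1) by (auto simp: h_def)
  have "F 1 = 0"
    by (simp add: F_def q1 Re0)
  then have "F (1 - h) < 0"
    using d(2) h by force
  moreover have "F (1 - h) \<ge> 0"
  proof -
    define z where "z = of_real (1 - h) * \<zeta>"
    have norm_z: "cmod z = (1 - h) * cmod \<zeta>"
      unfolding z_def norm_mult norm_of_real using h by simp
    then have "z \<in> ball 0 (cmod \<zeta>)"
      using h nz by simp
    then have "cmod \<zeta> * cmod (1 - p z) \<le> cmod z * cmod (1 + p z)"
      using schwarz_right_halfplane[OF hol p0] pos by simp
    then have "cmod (1 - p z) \<le> (1 - h) * cmod (1 + p z)"
      using nz by (simp add: norm_z)
    then have "(cmod (1 - p z))\<^sup>2 \<le> ((1 - h) * cmod (1 + p z))\<^sup>2"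
      by (intro power_mono) auto
    then show ?thesis
      unfolding power_mult_distrib cmod_power2 by (simp add: F_def q_def z_def)
  qed
  ultimately show False
    by simp
qed

theorem theorem1:
  fixes p :: "complex \<Rightarrow> complex"
  assumes "p analytic_on ball 0 1"
    and "p 0 = 1"
    and "\<And>z. z \<in> ball 0 1 \<Longrightarrow> cmod (z * deriv p z + p z + (p z)\<^sup>2 - 2) < 5 / 2"
  shows "\<forall>z \<in> ball 0 1. Re (p z) > 0"
proof (rule ccontr)
  assume "\<not> ?thesis"
  then obtain w where w: "w \<in> ball 0 1" "Re (p w) \<le> 0"
    by force
  have hol: "p holomorphic_on ball 0 1"
    using assms(1) by (rule analytic_imp_holomorphic)
  obtain \<zeta> where \<zeta>: "\<zeta> \<in> ball 0 1" "\<zeta> \<noteq> 0" "Re (p \<zeta>) = 0"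
    and pos: "\<And>z. cmod z < cmod \<zeta> \<Longrightarrow> Re (p z) > 0"
    using first_boundary_point[OF holomorphic_on_imp_continuous_on[OF hol] _ w] assms(2) by auto
  have "p holomorphic_on ball 0 (cmod \<zeta>)"
    using hol by (rule holomorphic_on_subset) (use \<zeta>(1) in auto)
  moreover have "p field_differentiable at \<zeta>"
    using hol \<zeta>(1) by (simp add: holomorphic_on_imp_differentiable_at)
  ultimately have "Re (\<zeta> * deriv p \<zeta>) \<le> - (1 + (Im (p \<zeta>))\<^sup>2) / 2"
    using radial_derivative_at_boundary_point assms(2) \<zeta> pos by blast
  moreover have "Re ((p \<zeta>)\<^sup>2) = - (Im (p \<zeta>))\<^sup>2"
    using \<zeta>(3) by (simp add: power2_eq_square)
  ultimately have "Re (\<zeta> * deriv p \<zeta> + p \<zeta> + (p \<zeta>)\<^sup>2 - 2) \<le> - (5 / 2) - 3 / 2 * (Im (p \<zeta>))\<^sup>2"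
    using \<zeta>(3) by (simp add: field_simps)
  then have "5 / 2 \<le> \<bar>Re (\<zeta> * deriv p \<zeta> + p \<zeta> + (p \<zeta>)\<^sup>2 - 2)\<bar>"
    using zero_le_power2[of "Im (p \<zeta>)"] by linarith
  also have "\<dots> \<le> cmod (\<zeta> * deriv p \<zeta> + p \<zeta> + (p \<zeta>)\<^sup>2 - 2)"
    by (rule abs_Re_le_cmod)
  finally show False
    using assms(3)[OF \<zeta>(1)] by simp
qed

end
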